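(* Let $(X,\mathcal{X},\mu,T)$ be an ergodic measure preserving system, rigid for the sequence $(n_i)_{i\in\mathbb{N}}$. Then there exist a subsequence $(n_i')_{i\in\mathbb{N}}$ of $(n_i)_{i\in\mathbb{N}}$ and a separable subalgebra $\mathcal{A}\subset L^\infty(\mu)$ which is dense in $L^{2}(\mu)$ such that $\|f-f\circ T^{n_i'}\|_{\infty}\to 0$ as $i\to\infty$ for any $f\in\mathcal{A}$.
   Context: A measure preserving system is a 4-tuple $(X,\mathcal{X},\mu,T)$ where $(X,\mathcal{X},\mu)$ is a probability space and $T$ is a measurable measure preserving transformation of $X$; $T$ is assumed to be invertible, with both $T$ and $T^{-1}$ measure preserving. It is ergodic if every invariant set has measure $0$ or $1$. The system $(X,\mathcal{X},\mu,T)$ is rigid for the increasing sequence $(n_i)_{i\in\mathbb{N}}$ in $\mathbb{N}$ if $\|f-f\circ T^{n_i}\|_{2}\to 0$ as $i\to\infty$ for every $f\in L^2(\mu)$. $\|\cdot\|_\infty$ denotes the essential supremum norm.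
   Formalization: The formal statement additionally assumes that L^2(mu) is separable (as for standard probability spaces); this is implied by the conclusion, and without it the claim fails, e.g. for rigid ergodic rotations of non-metrizable compact groups. *)

theory Defs
  imports "HOL-Probability.Essential_Supremum" "HOL-Probability.Probability_Measure"
begin

section \<open>Measure preserving systems\<close>

definition measure_preserving :: "'a measure \<Rightarrow> ('a \<Rightarrow> 'a) \<Rightarrow> bool" where
  "measure_preserving M T \<longleftrightarrow> T \<in> M \<rightarrow>\<^sub>M M \<and> distr M M T = M"

definition measure_preserving_system :: "'a measure \<Rightarrow> ('a \<Rightarrow> 'a) \<Rightarrow> bool" where
  "measure_preserving_system M T \<longleftrightarrow>
     prob_space M \<and>
     bij_betw T (space M) (space M) \<and>
     measure_preserving M T \<and>
     measure_preserving M (inv_into (space M) T)"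

definition ergodic_system :: "'a measure \<Rightarrow> ('a \<Rightarrow> 'a) \<Rightarrow> bool" where
  "ergodic_system M T \<longleftrightarrow>
     measure_preserving_system M T \<and>
     (\<forall>E\<in>sets M. T -` E \<inter> space M = E \<longrightarrow> measure M E = 0 \<or> measure M E = 1)"

section \<open>The spaces of square integrable and of essentially bounded functions\<close>

text \<open>Elements are represented by measurable functions rather than by classes modulo
  almost everywhere equality; accordingly the two norms below are seminorms.\<close>

definition L2_space :: "'a measure \<Rightarrow> ('a \<Rightarrow> complex) set" where
  "L2_space M = {f \<in> borel_measurable M. integrable M (\<lambda>x. (norm (f x))\<^sup>2)}"

definition L2_norm :: "'a measure \<Rightarrow> ('a \<Rightarrow> complex) \<Rightarrow> real" where
  "L2_norm M f = sqrt (\<integral>x. (norm (f x))\<^sup>2 \<partial>M)"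

definition Linf_norm :: "'a measure \<Rightarrow> ('a \<Rightarrow> complex) \<Rightarrow> ereal" where
  "Linf_norm M f = esssup M (\<lambda>x. ereal (norm (f x)))"

definition Linf_space :: "'a measure \<Rightarrow> ('a \<Rightarrow> complex) set" where
  "Linf_space M = {f \<in> borel_measurable M. Linf_norm M f < \<infinity>}"

text \<open>The last conjunct makes \<open>A\<close> a union of classes modulo almost everywhere equality, so
  that such sets \<open>A\<close> correspond exactly to the subalgebras of the quotient algebra.\<close>

definition Linf_subalgebra :: "'a measure \<Rightarrow> ('a \<Rightarrow> complex) set \<Rightarrow> bool" where
  "Linf_subalgebra M A \<longleftrightarrow>
     A \<subseteq> Linf_space M \<and>
     (\<lambda>x. 0) \<in> A \<and>
     (\<forall>f\<in>A. \<forall>g\<in>A. (\<lambda>x. f x + g x) \<in> A) \<and>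
     (\<forall>c. \<forall>f\<in>A. (\<lambda>x. c * f x) \<in> A) \<and>
     (\<forall>f\<in>A. \<forall>g\<in>A. (\<lambda>x. f x * g x) \<in> A) \<and>
     (\<forall>f\<in>A. \<forall>g\<in>borel_measurable M. (AE x in M. f x = g x) \<longrightarrow> g \<in> A)"

text \<open>Density and separability for the distance \<open>N (f - g)\<close>. The codomain of \<open>N\<close> is left open
  because \<open>L2_norm\<close> is real valued and \<open>Linf_norm\<close> is extended real valued.

  Separability of \<open>L2_space M\<close> is the part of the usual convention that probability spaces are
  standard which matters here: it follows from the existence of an \<open>L2_norm\<close>-dense subset of
  \<open>Linf_space M\<close> that is separable for \<open>Linf_norm\<close>, and can fail for ergodic rotations of
  non-metrizable compact groups.\<close>

definition dense_for ::
  "(('a \<Rightarrow> complex) \<Rightarrow> 'e::{zero,ord}) \<Rightarrow> ('a \<Rightarrow> complex) set \<Rightarrow> ('a \<Rightarrow> complex) set \<Rightarrow> bool" where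
  "dense_for N D S \<longleftrightarrow> D \<subseteq> S \<and> (\<forall>f\<in>S. \<forall>e>0. \<exists>g\<in>D. N (\<lambda>x. f x - g x) < e)"

definition separable_for ::
  "(('a \<Rightarrow> complex) \<Rightarrow> 'e::{zero,ord}) \<Rightarrow> ('a \<Rightarrow> complex) set \<Rightarrow> bool" where
  "separable_for N S \<longleftrightarrow> (\<exists>D. countable D \<and> dense_for N D S)"

section \<open>Rigidity\<close>

definition rigid_for :: "'a measure \<Rightarrow> ('a \<Rightarrow> 'a) \<Rightarrow> (nat \<Rightarrow> nat) \<Rightarrow> bool" where
  "rigid_for M T n \<longleftrightarrow>
     (\<forall>f\<in>L2_space M. (\<lambda>i. L2_norm M (\<lambda>x. f x - f ((T ^^ n i) x))) \<longlonglongrightarrow> 0)"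

end

theory Submission
  imports Defs
begin

text \<open>The idea is to replace a function by a nearby one that is Lipschitz along the orbits.
  Let \<open>g\<close> be bounded, let \<open>q\<close> be a time and \<open>c > 0\<close>. The infimal convolution
  \<open>g' x = (INF m. g (T^(m q) x) + c \<bar>m\<bar>)\<close>, with \<open>m\<close> ranging over the integers, satisfies
  \<open>\<bar>g' x - g' (T^q x)\<bar> \<le> c\<close> at every point, since moving \<open>x\<close> by \<open>T^q\<close> only shifts \<open>m\<close> by one. If
  \<open>\<bar>g\<bar> \<le> 1\<close>, only the \<open>m\<close> with \<open>c \<bar>m\<bar> \<le> 2\<close> can make \<open>g'\<close> smaller than \<open>g\<close>, so that the \<open>L1\<close>
  distance from \<open>g\<close> to \<open>g'\<close> is at most a finite sum of the distances from \<open>g\<close> to \<open>g \<circ> T^(m q)\<close>.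
  For a fixed \<open>c\<close> it therefore becomes as small as desired when \<open>q\<close> is taken far out in the
  rigidity sequence (\<open>inf_conv_L1_tendsto\<close>). Finally, a bound on \<open>\<bar>g - g \<circ> T^p\<bar>\<close> that holds
  for another time \<open>p\<close> is inherited by \<open>g'\<close>, because the powers of \<open>T\<close> commute.

  Hence the operation can be iterated. Stage \<open>j\<close> uses the cost \<open>c = 1 / (j + 1)\<close> and chooses a time
  of the sequence so late that each of the finitely many functions treated at this stage
  moves by at most \<open>2^(-j)\<close> in \<open>L1\<close>. The iterates decrease, and their limits are close in
  \<open>L1\<close> to the functions at the start and return to themselves uniformly along the
  chosen times (\<open>simultaneous_regularization\<close>).

  The procedure is applied to truncated real and imaginary parts of a countable dense set
  of square integrable functions. Let \<open>A\<close> be the closure, for the essential supremum norm, of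
  the countable ring generated by the limits and by the constants with rational real and
  imaginary part. Uniform return survives sums, products and uniform limits, so it holds on
  \<open>A\<close>. The \<open>L2\<close> closure of \<open>A\<close> is a closed linear space that contains the truncations, hence
  the dense set, hence everything (\<open>L2_space_subset_closure\<close>).\<close>

section \<open>Measure preserving actions of the integers\<close>

locale measure_preserving_flow = prob_space M
  for M :: "'a measure" and \<tau> :: "int \<Rightarrow> 'a \<Rightarrow> 'a" +
  assumes flow_preserving: "measure_preserving M (\<tau> m)"
    and flow_zero: "x \<in> space M \<Longrightarrow> \<tau> 0 x = x"
    and flow_add: "x \<in> space M \<Longrightarrow> \<tau> (a + b) x = \<tau> a (\<tau> b x)"
begin

lemma flow_measurable [measurable]: "\<tau> m \<in> M \<rightarrow>\<^sub>M M"
  using flow_preserving by (simp add: measure_preserving_def)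

lemma flow_space: "x \<in> space M \<Longrightarrow> \<tau> m x \<in> space M"
  using measurable_space[OF flow_measurable] .

lemma integral_flow:
  fixes u :: "'a \<Rightarrow> real"
  assumes [measurable]: "u \<in> borel_measurable M"
  shows "(\<integral>x. u (\<tau> m x) \<partial>M) = (\<integral>x. u x \<partial>M)"
proof -
  have "distr M M (\<tau> m) = M"
    using flow_preserving by (simp add: measure_preserving_def)
  then show ?thesis
    using integral_distr[OF flow_measurable[of m] assms] by simp
qed

end

text \<open>The inverse of \<open>T\<close> is only meaningful on \<open>space M\<close>; outside of it the negative powers
  take arbitrary values, which is why the laws of a flow are restricted to \<open>space M\<close>.\<close>

definition iterate_int :: "'a measure \<Rightarrow> ('a \<Rightarrow> 'a) \<Rightarrow> int \<Rightarrow> 'a \<Rightarrow> 'a" where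
  "iterate_int M T m =
     (if m \<ge> 0 then T ^^ nat m else inv_into (space M) T ^^ nat (- m))"

lemma iterate_int_of_nat [simp]: "iterate_int M T (int k) = T ^^ k"
  by (simp add: iterate_int_def)

lemma measure_preserving_funpow:
  assumes "measure_preserving M T"
  shows "measure_preserving M (T ^^ k)"
proof (induction k)
  case 0
  then show ?case by (simp add: measure_preserving_def id_def distr_id)
next
  case (Suc k)
  then show ?case
    using assms unfolding measure_preserving_def
    by (metis comp_apply distr_distr funpow.simps(2) measurable_comp)
qed

lemma iterate_int_flow:
  assumes "measure_preserving_system M T"
  shows "measure_preserving_flow M (iterate_int M T)"
proof -
  let ?S = "inv_into (space M) T" and ?\<tau> = "iterate_int M T"
  have bij: "bij_betw T (space M) (space M)"
    and T: "measure_preserving M T" and S: "measure_preserving M ?S"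
    using assms by (auto simp: measure_preserving_system_def)
  interpret prob_space M
    using assms by (simp add: measure_preserving_system_def)
  have pres: "measure_preserving M (?\<tau> m)" for m
    using measure_preserving_funpow[OF T] measure_preserving_funpow[OF S]
    by (simp add: iterate_int_def)
  have in_space: "?\<tau> m x \<in> space M" if "x \<in> space M" for m x
    using pres[of m] that by (auto simp: measure_preserving_def dest: measurable_space)
  have TS: "T (?S x) = x" and ST: "?S (T x) = x" if "x \<in> space M" for x
    using that bij by (auto simp: bij_betw_def f_inv_into_f)
  have step: "?\<tau> (m + 1) x = T (?\<tau> m x)" if x: "x \<in> space M" for m x
  proof (cases "m \<ge> 0")
    case True
    then show ?thesis by (simp add: iterate_int_def nat_add_distrib)
  next
    case False
    define k where "k = nat (- m - 1)"
    have m: "m = - int (Suc k)" using False by (simp add: k_def)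
    have "(?S ^^ k) x = ?\<tau> (- int k) x"
      by (simp add: iterate_int_def)
    moreover have "?\<tau> m x = ?S ((?S ^^ k) x)"
      by (simp add: iterate_int_def m del: of_nat_Suc)
    ultimately show ?thesis
      using TS[OF in_space[OF x, of "- int k"]] by (simp add: m)
  qed
  have down: "?\<tau> (m - 1) x = ?S (?\<tau> m x)" if x: "x \<in> space M" for m x
    using step[OF x, of "m - 1"] ST[OF in_space[OF x, of "m - 1"]] by simp
  have add: "?\<tau> (a + b) x = ?\<tau> a (?\<tau> b x)" if x: "x \<in> space M" for a b x
  proof (induction a rule: int_induct[where k = 0])
    case base
    then show ?case by (simp add: iterate_int_def)
  next
    case (step1 i)
    then show ?case
      using step[OF x, of "i + b"] step[OF in_space[OF x, of b], of i] by (simp add: ac_simps)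
  next
    case (step2 i)
    then show ?case
      using down[OF x, of "i + b"] down[OF in_space[OF x, of b], of i]
      by (simp add: algebra_simps)
  qed
  show ?thesis
    by unfold_locales (auto simp: pres add, simp add: iterate_int_def)
qed

section \<open>Infimal convolution along an orbit\<close>

definition unit_bounded :: "'a measure \<Rightarrow> ('a \<Rightarrow> real) \<Rightarrow> bool" where
  "unit_bounded M g \<longleftrightarrow> g \<in> borel_measurable M \<and> (\<forall>x\<in>space M. \<bar>g x\<bar> \<le> 1)"

definition lipschitz_along :: "'a measure \<Rightarrow> real \<Rightarrow> ('a \<Rightarrow> 'a) \<Rightarrow> ('a \<Rightarrow> real) \<Rightarrow> bool" where
  "lipschitz_along M c U g \<longleftrightarrow> (\<forall>x\<in>space M. \<bar>g x - g (U x)\<bar> \<le> c)"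

text \<open>The cost of reaching \<open>\<tau> (m * q) x\<close> from \<open>x\<close> is proportional to the number of steps and not to
  the time \<open>m * q\<close>. Thus \<open>c\<close> bounds the increment over one step of length \<open>q\<close>, however large \<open>q\<close>
  is. Both signs of \<open>m\<close> are needed to bound the increment from both sides.\<close>

definition inf_conv :: "(int \<Rightarrow> 'a \<Rightarrow> 'a) \<Rightarrow> real \<Rightarrow> int \<Rightarrow> ('a \<Rightarrow> real) \<Rightarrow> 'a \<Rightarrow> real" where
  "inf_conv \<tau> c q g x = (INF m. g (\<tau> (m * q) x) + c * \<bar>real_of_int m\<bar>)"

lemma cINF_le_add:
  fixes a :: "'i \<Rightarrow> real" and b :: "'j \<Rightarrow> real"
  assumes "bdd_below (range a)" and "\<And>m. \<exists>m'. a m' \<le> b m + e"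
  shows "Inf (range a) \<le> Inf (range b) + e"
proof -
  have "Inf (range a) - e \<le> b m" for m
    using assms(2)[of m] cINF_lower[OF assms(1)]
    by (smt (verit) UNIV_I)
  then have "Inf (range a) - e \<le> Inf (range b)"
    by (intro cINF_greatest) auto
  then show ?thesis by simp
qed

lemma (in prob_space) integral_abs_le_sqrt:
  fixes u :: "'a \<Rightarrow> real"
  assumes "integrable M u" "integrable M (\<lambda>x. (u x)\<^sup>2)"
  shows "(\<integral>x. \<bar>u x\<bar> \<partial>M) \<le> sqrt (\<integral>x. (u x)\<^sup>2 \<partial>M)"
proof -
  have "0 \<le> variance (\<lambda>x. \<bar>u x\<bar>)" by (rule variance_positive)
  also have "\<dots> = (\<integral>x. (u x)\<^sup>2 \<partial>M) - (\<integral>x. \<bar>u x\<bar> \<partial>M)\<^sup>2"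
    using assms by (subst variance_eq) auto
  finally show ?thesis by (intro real_le_rsqrt) simp
qed

lemma (in finite_measure) unit_bounded_integrable:
  "unit_bounded M g \<Longrightarrow> integrable M g"
  by (rule integrable_const_bound[where B = 1]) (auto simp: unit_bounded_def)

context measure_preserving_flow
begin

lemma unit_bounded_flow: "unit_bounded M g \<Longrightarrow> unit_bounded M (\<lambda>x. g (\<tau> m x))"
  by (auto simp: unit_bounded_def flow_space)

lemma bdd_below_inf_conv:
  assumes "unit_bounded M g" "0 \<le> c" "x \<in> space M"
  shows "bdd_below (range (\<lambda>m. g (\<tau> (m * q) x) + c * \<bar>real_of_int m\<bar>))"
proof (rule bdd_belowI2[where m = "-1"])
  fix m
  have "-1 \<le> g (\<tau> (m * q) x)"
    using assms(1) flow_space[OF assms(3), of "m * q"] by (auto simp: unit_bounded_def abs_le_iff)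
  moreover have "0 \<le> c * \<bar>real_of_int m\<bar>" using assms(2) by simp
  ultimately show "-1 \<le> g (\<tau> (m * q) x) + c * \<bar>real_of_int m\<bar>" by linarith
qed

lemma inf_conv_le:
  assumes "unit_bounded M g" "0 \<le> c" "x \<in> space M"
  shows "inf_conv \<tau> c q g x \<le> g x"
  using cINF_lower[OF bdd_below_inf_conv[OF assms], of 0 q] assms(3)
  by (simp add: inf_conv_def flow_zero)

lemma unit_bounded_inf_conv:
  assumes g: "unit_bounded M g" and c: "0 \<le> c"
  shows "unit_bounded M (inf_conv \<tau> c q g)"
  unfolding unit_bounded_def
proof
  have [measurable]: "g \<in> borel_measurable M" using g by (simp add: unit_bounded_def)
  show "inf_conv \<tau> c q g \<in> borel_measurable M"
    unfolding inf_conv_def by measurable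
  show "\<forall>x\<in>space M. \<bar>inf_conv \<tau> c q g x\<bar> \<le> 1"
  proof
    fix x assume x: "x \<in> space M"
    have "inf_conv \<tau> c q g x \<le> 1"
      using inf_conv_le[OF g c x, of q] g x by (force simp: unit_bounded_def abs_le_iff)
    moreover have "-1 \<le> inf_conv \<tau> c q g x"
      unfolding inf_conv_def
    proof (rule cINF_greatest)
      fix m
      have "-1 \<le> g (\<tau> (m * q) x)"
        using g flow_space[OF x, of "m * q"] by (auto simp: unit_bounded_def abs_le_iff)
      moreover have "0 \<le> c * \<bar>real_of_int m\<bar>" using c by simp
      ultimately show "-1 \<le> g (\<tau> (m * q) x) + c * \<bar>real_of_int m\<bar>" by linarith
    qed simp
    ultimately show "\<bar>inf_conv \<tau> c q g x\<bar> \<le> 1" by simp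
  qed
qed

text \<open>A path from \<open>\<tau> q x\<close> becomes a path from \<open>x\<close> to the same point after a change of \<open>m\<close> by one,
  and conversely; either way the cost grows by at most \<open>c\<close>.\<close>

lemma lipschitz_along_inf_conv:
  assumes g: "unit_bounded M g" and c: "0 \<le> c"
  shows "lipschitz_along M c (\<tau> q) (inf_conv \<tau> c q g)"
  unfolding lipschitz_along_def
proof
  fix x assume x: "x \<in> space M"
  note y = flow_space[OF x, of q]
  have shift: "\<tau> (m * q) (\<tau> q x) = \<tau> ((m + 1) * q) x" for m
    using flow_add[OF x, of "m * q" q] by (simp add: algebra_simps)
  have mult: "c * \<bar>real_of_int (m + s)\<bar> \<le> c * \<bar>real_of_int m\<bar> + c" if "\<bar>s\<bar> = 1" for m s
  proof -
    have "c * \<bar>real_of_int (m + s)\<bar> \<le> c * (\<bar>real_of_int m\<bar> + 1)"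
      using that by (intro mult_left_mono c) linarith
    then show ?thesis by (simp add: algebra_simps)
  qed
  have "inf_conv \<tau> c q g x \<le> inf_conv \<tau> c q g (\<tau> q x) + c"
    unfolding inf_conv_def
  proof (rule cINF_le_add[OF bdd_below_inf_conv[OF g c x]])
    fix m
    show "\<exists>m'. g (\<tau> (m' * q) x) + c * \<bar>real_of_int m'\<bar>
        \<le> g (\<tau> (m * q) (\<tau> q x)) + c * \<bar>real_of_int m\<bar> + c"
      using mult[of 1 m] by (intro exI[of _ "m + 1"]) (simp add: shift)
  qed
  moreover have "inf_conv \<tau> c q g (\<tau> q x) \<le> inf_conv \<tau> c q g x + c"
    unfolding inf_conv_def
  proof (rule cINF_le_add[OF bdd_below_inf_conv[OF g c y]])
    fix m
    show "\<exists>m'. g (\<tau> (m' * q) (\<tau> q x)) + c * \<bar>real_of_int m'\<bar>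
        \<le> g (\<tau> (m * q) x) + c * \<bar>real_of_int m\<bar> + c"
      using mult[of "-1" m] by (intro exI[of _ "m - 1"]) (simp add: shift)
  qed
  ultimately show "\<bar>inf_conv \<tau> c q g x - inf_conv \<tau> c q g (\<tau> q x)\<bar> \<le> c" by linarith
qed

text \<open>The times commute, so \<open>inf_conv\<close> is an infimum of translates of \<open>g\<close> (plus constants), each
  of which satisfies the same bound along \<open>\<tau> p\<close>. This keeps what earlier stages of an
  iteration have achieved.\<close>

lemma lipschitz_along_inf_conv_other:
  assumes g: "unit_bounded M g" and c: "0 \<le> c" and b: "lipschitz_along M b (\<tau> p) g"
  shows "lipschitz_along M b (\<tau> p) (inf_conv \<tau> c q g)"
  unfolding lipschitz_along_def
proof
  fix x assume x: "x \<in> space M"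
  have "\<bar>g (\<tau> (m * q) x) - g (\<tau> (m * q) (\<tau> p x))\<bar> \<le> b" for m
  proof -
    have "\<tau> (m * q) (\<tau> p x) = \<tau> p (\<tau> (m * q) x)"
      using flow_add[OF x, of "m * q" p] flow_add[OF x, of p "m * q"] by (simp add: add.commute)
    then show ?thesis
      using b flow_space[OF x, of "m * q"] by (simp add: lipschitz_along_def)
  qed
  then have le: "g (\<tau> (m * q) x) + c * \<bar>real_of_int m\<bar>
        \<le> g (\<tau> (m * q) (\<tau> p x)) + c * \<bar>real_of_int m\<bar> + b"
    and ge: "g (\<tau> (m * q) (\<tau> p x)) + c * \<bar>real_of_int m\<bar>
        \<le> g (\<tau> (m * q) x) + c * \<bar>real_of_int m\<bar> + b" for m
    by (smt (verit))+
  have "inf_conv \<tau> c q g x \<le> inf_conv \<tau> c q g (\<tau> p x) + b"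
    unfolding inf_conv_def using le
    by (intro cINF_le_add[OF bdd_below_inf_conv[OF g c x]]) blast
  moreover have "inf_conv \<tau> c q g (\<tau> p x) \<le> inf_conv \<tau> c q g x + b"
    unfolding inf_conv_def using ge
    by (intro cINF_le_add[OF bdd_below_inf_conv[OF g c flow_space[OF x]]]) blast
  ultimately show "\<bar>inf_conv \<tau> c q g x - inf_conv \<tau> c q g (\<tau> p x)\<bar> \<le> b" by linarith
qed

text \<open>Beyond \<open>K\<close> steps the cost is at least \<open>2\<close>, the largest possible drop of \<open>g\<close>, and cannot pay off.
  For fewer steps the gain is at most the change of \<open>g\<close>. The bound \<open>K\<close> does not depend on \<open>q\<close>,
  so a fixed finite number of return times is involved.\<close>

lemma inf_conv_gap_le:
  assumes g: "unit_bounded M g" and c: "0 < c" and K: "2 \<le> c * real_of_int K" and x: "x \<in> space M"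
  shows "g x - inf_conv \<tau> c q g x \<le> (\<Sum>m\<in>{-K..K}. \<bar>g x - g (\<tau> (m * q) x)\<bar>)"
proof -
  let ?s = "\<Sum>m\<in>{-K..K}. \<bar>g x - g (\<tau> (m * q) x)\<bar>"
  have "g x - ?s \<le> inf_conv \<tau> c q g x"
    unfolding inf_conv_def
  proof (rule cINF_greatest)
    fix m
    have s: "0 \<le> ?s" by (simp add: sum_nonneg)
    have bd: "g x \<le> 1" "-1 \<le> g (\<tau> (m * q) x)"
      using g x flow_space[OF x, of "m * q"] by (auto simp: unit_bounded_def abs_le_iff)
    show "g x - ?s \<le> g (\<tau> (m * q) x) + c * \<bar>real_of_int m\<bar>"
    proof (cases "m \<in> {-K..K}")
      case True
      then have "\<bar>g x - g (\<tau> (m * q) x)\<bar> \<le> ?s"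
        by (intro member_le_sum) auto
      moreover have "0 \<le> c * \<bar>real_of_int m\<bar>" using c by simp
      ultimately show ?thesis by linarith
    next
      case False
      then have "c * real_of_int K \<le> c * \<bar>real_of_int m\<bar>"
        using c by (intro mult_left_mono) auto
      then show ?thesis using K bd s by linarith
    qed
  qed simp
  then show ?thesis by simp
qed

text \<open>For positive \<open>m\<close>, the triangle inequality bounds the distance by \<open>m\<close> times the distance for
  one step; negative \<open>m\<close> reduce to \<open>- m\<close> by invariance of the measure.\<close>

lemma L1_return_multiple:
  assumes g: "unit_bounded M g"
    and lim: "(\<lambda>i. \<integral>x. \<bar>g x - g (\<tau> (q i) x)\<bar> \<partial>M) \<longlonglongrightarrow> 0"
  shows "(\<lambda>i. \<integral>x. \<bar>g x - g (\<tau> (m * q i) x)\<bar> \<partial>M) \<longlonglongrightarrow> 0"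
proof -
  have [measurable]: "g \<in> borel_measurable M" using g by (simp add: unit_bounded_def)
  have int: "integrable M (\<lambda>x. g (\<tau> a x))" for a
    using unit_bounded_integrable[OF unit_bounded_flow[OF g]] .
  have int0: "integrable M g" using unit_bounded_integrable[OF g] .
  have nat: "(\<lambda>i. \<integral>x. \<bar>g x - g (\<tau> (int k * q i) x)\<bar> \<partial>M) \<longlonglongrightarrow> 0" for k
  proof (induction k)
    case 0
    have "(\<integral>x. \<bar>g x - g (\<tau> 0 x)\<bar> \<partial>M) = (\<integral>x. 0 \<partial>M)"
      by (rule Bochner_Integration.integral_cong) (auto simp: flow_zero)
    then show ?case by simp
  next
    case (Suc k)
    have bound: "(\<integral>x. \<bar>g x - g (\<tau> (int (Suc k) * q i) x)\<bar> \<partial>M)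
        \<le> (\<integral>x. \<bar>g x - g (\<tau> (int k * q i) x)\<bar> \<partial>M) + (\<integral>x. \<bar>g x - g (\<tau> (q i) x)\<bar> \<partial>M)" for i
    proof -
      let ?a = "int k * q i"
      have eq: "\<tau> (int (Suc k) * q i) x = \<tau> (q i) (\<tau> ?a x)" if "x \<in> space M" for x
        using flow_add[OF that, of "q i" ?a] by (simp add: algebra_simps)
      have "(\<integral>x. \<bar>g x - g (\<tau> (int (Suc k) * q i) x)\<bar> \<partial>M)
          \<le> (\<integral>x. \<bar>g x - g (\<tau> ?a x)\<bar> + \<bar>g (\<tau> ?a x) - g (\<tau> (int (Suc k) * q i) x)\<bar> \<partial>M)"
        by (rule integral_mono) (use int int0 in auto)
      also have "\<dots> = (\<integral>x. \<bar>g x - g (\<tau> ?a x)\<bar> \<partial>M)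
          + (\<integral>x. \<bar>g (\<tau> ?a x) - g (\<tau> (int (Suc k) * q i) x)\<bar> \<partial>M)"
        by (rule Bochner_Integration.integral_add) (use int int0 in auto)
      also have "(\<integral>x. \<bar>g (\<tau> ?a x) - g (\<tau> (int (Suc k) * q i) x)\<bar> \<partial>M)
          = (\<integral>x. \<bar>g (\<tau> ?a x) - g (\<tau> (q i) (\<tau> ?a x))\<bar> \<partial>M)"
        by (rule Bochner_Integration.integral_cong) (simp_all only: eq)
      also have "\<dots> = (\<integral>x. \<bar>g x - g (\<tau> (q i) x)\<bar> \<partial>M)"
        by (rule integral_flow[where u = "\<lambda>x. \<bar>g x - g (\<tau> (q i) x)\<bar>"]) measurable
      finally show ?thesis .
    qed
    show ?case
      by (rule tendsto_sandwich[OF _ _ tendsto_const tendsto_add_zero[OF Suc lim]])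
        (use bound in auto)
  qed
  show ?thesis
  proof (cases "m \<ge> 0")
    case True
    then show ?thesis using nat[of "nat m"] by simp
  next
    case False
    have "(\<integral>x. \<bar>g x - g (\<tau> (m * q i) x)\<bar> \<partial>M) = (\<integral>x. \<bar>g x - g (\<tau> (- m * q i) x)\<bar> \<partial>M)" for i
    proof -
      have "(\<integral>x. \<bar>g x - g (\<tau> (m * q i) x)\<bar> \<partial>M)
          = (\<integral>x. \<bar>g (\<tau> (- m * q i) x) - g (\<tau> (m * q i) (\<tau> (- m * q i) x))\<bar> \<partial>M)"
        by (rule integral_flow[symmetric, where u = "\<lambda>x. \<bar>g x - g (\<tau> (m * q i) x)\<bar>"]) measurable
      also have "\<dots> = (\<integral>x. \<bar>g x - g (\<tau> (- m * q i) x)\<bar> \<partial>M)"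
      proof (rule Bochner_Integration.integral_cong[OF refl])
        fix x assume x: "x \<in> space M"
        have "\<tau> (m * q i) (\<tau> (- m * q i) x) = x"
          using flow_add[OF x, of "m * q i" "- m * q i"] flow_zero[OF x] by simp
        then show "\<bar>g (\<tau> (- m * q i) x) - g (\<tau> (m * q i) (\<tau> (- m * q i) x))\<bar>
            = \<bar>g x - g (\<tau> (- m * q i) x)\<bar>"
          by (simp add: abs_minus_commute)
      qed
      finally show ?thesis .
    qed
    then show ?thesis using nat[of "nat (- m)"] False by simp
  qed
qed

lemma inf_conv_L1_tendsto:
  assumes g: "unit_bounded M g" and c: "0 < c"
    and lim: "(\<lambda>i. \<integral>x. \<bar>g x - g (\<tau> (q i) x)\<bar> \<partial>M) \<longlonglongrightarrow> 0"
  shows "(\<lambda>i. \<integral>x. g x - inf_conv \<tau> c (q i) g x \<partial>M) \<longlonglongrightarrow> 0"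
proof -
  obtain K where K: "2 \<le> c * real_of_int K"
    using c ex_le_of_int[of "2 / c"] by (auto simp: field_simps)
  have int: "integrable M (\<lambda>x. \<bar>g x - g (\<tau> a x)\<bar>)" for a
    using unit_bounded_integrable[OF unit_bounded_flow[OF g]] unit_bounded_integrable[OF g] by auto
  have intc: "integrable M (\<lambda>x. g x - inf_conv \<tau> c (q i) g x)" for i
    using unit_bounded_integrable[OF unit_bounded_inf_conv[OF g]] unit_bounded_integrable[OF g] c
    by auto
  have upper: "(\<integral>x. g x - inf_conv \<tau> c (q i) g x \<partial>M)
      \<le> (\<Sum>m\<in>{-K..K}. \<integral>x. \<bar>g x - g (\<tau> (m * q i) x)\<bar> \<partial>M)" for i
  proof -
    have "(\<integral>x. g x - inf_conv \<tau> c (q i) g x \<partial>M)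
        \<le> (\<integral>x. (\<Sum>m\<in>{-K..K}. \<bar>g x - g (\<tau> (m * q i) x)\<bar>) \<partial>M)"
      using inf_conv_gap_le[OF g c K] int intc by (intro integral_mono) auto
    also have "\<dots> = (\<Sum>m\<in>{-K..K}. \<integral>x. \<bar>g x - g (\<tau> (m * q i) x)\<bar> \<partial>M)"
      using int by (intro Bochner_Integration.integral_sum)
    finally show ?thesis .
  qed
  have lower: "0 \<le> (\<integral>x. g x - inf_conv \<tau> c (q i) g x \<partial>M)" for i
    using inf_conv_le[OF g] c by (intro integral_nonneg_AE) auto
  have sum: "(\<lambda>i. \<Sum>m\<in>{-K..K}. \<integral>x. \<bar>g x - g (\<tau> (m * q i) x)\<bar> \<partial>M) \<longlonglongrightarrow> 0"
    using L1_return_multiple[OF g lim] by (intro tendsto_null_sum) auto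
  show ?thesis
    by (rule tendsto_sandwich[OF always_eventually always_eventually tendsto_const sum])
      (intro allI lower upper)+
qed

text \<open>Rigidity is assumed in \<open>L2\<close>; on a probability space the \<open>L1\<close> norm is the smaller one.\<close>

lemma L1_return_of_rigid:
  assumes g: "unit_bounded M g" and rigid: "rigid_for M T n" and nat_flow: "\<And>k. \<tau> (int k) = T ^^ k"
  shows "(\<lambda>i. \<integral>x. \<bar>g x - g (\<tau> (int (n i)) x)\<bar> \<partial>M) \<longlonglongrightarrow> 0"
proof -
  have [measurable]: "g \<in> borel_measurable M" using g by (simp add: unit_bounded_def)
  have sq: "integrable M (\<lambda>x. (g x)\<^sup>2)"
  proof (rule integrable_const_bound[where B = 1])
    show "AE x in M. norm ((g x)\<^sup>2) \<le> 1"
      using g by (intro AE_I2) (simp add: unit_bounded_def abs_square_le_1)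
  qed measurable
  then have "(\<lambda>x. complex_of_real (g x)) \<in> L2_space M"
    by (simp add: L2_space_def)
  from bspec[OF rigid[unfolded rigid_for_def] this]
  have "(\<lambda>i. L2_norm M (\<lambda>x. complex_of_real (g x) - complex_of_real (g ((T ^^ n i) x))))
      \<longlonglongrightarrow> 0" .
  then have lim: "(\<lambda>i. sqrt (\<integral>x. (g x - g (\<tau> (int (n i)) x))\<^sup>2 \<partial>M)) \<longlonglongrightarrow> 0"
    unfolding L2_norm_def nat_flow of_real_diff[symmetric] norm_of_real power2_abs .
  have "(\<integral>x. \<bar>g x - g (\<tau> a x)\<bar> \<partial>M) \<le> sqrt (\<integral>x. (g x - g (\<tau> a x))\<^sup>2 \<partial>M)" for a
  proof (rule integral_abs_le_sqrt)
    have le: "\<bar>g x - g (\<tau> a x)\<bar> \<le> 2" if "x \<in> space M" for x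
    proof -
      have "\<bar>g x\<bar> \<le> 1" "\<bar>g (\<tau> a x)\<bar> \<le> 1"
        using g that flow_space[OF that, of a] by (auto simp: unit_bounded_def)
      then show ?thesis by linarith
    qed
    show "integrable M (\<lambda>x. g x - g (\<tau> a x))"
      by (rule integrable_const_bound[where B = 2]) (use le in auto)
    have "(g x - g (\<tau> a x))\<^sup>2 \<le> 2\<^sup>2" if "x \<in> space M" for x
      using le[OF that] abs_le_square_iff[of "g x - g (\<tau> a x)" 2] by simp
    then show "integrable M (\<lambda>x. (g x - g (\<tau> a x))\<^sup>2)"
      by (intro integrable_const_bound[where B = "2\<^sup>2"]) auto
  qed
  then show ?thesis
    by (intro tendsto_sandwich[OF _ _ tendsto_const lim]) auto
qed

end

section \<open>Regularizing countably many functions along one subsequence\<close>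

context measure_preserving_flow
begin

lemma monotone_limit_unit_bounded:
  assumes F: "\<And>j. unit_bounded M (F j)"
    and dec: "\<And>j x. x \<in> space M \<Longrightarrow> F (Suc j) x \<le> F j x"
    and bound: "\<And>j. (\<integral>x. f x - F j x \<partial>M) \<le> e" and f: "unit_bounded M f"
    and below: "\<And>j x. x \<in> space M \<Longrightarrow> F j x \<le> f x"
  defines "G \<equiv> \<lambda>x. INF j. F j x"
  shows "unit_bounded M G" "(\<integral>x. \<bar>f x - G x\<bar> \<partial>M) \<le> e"
    "\<And>x. x \<in> space M \<Longrightarrow> (\<lambda>j. F j x) \<longlonglongrightarrow> G x"
proof -
  have [measurable]: "F j \<in> borel_measurable M" for j using F by (simp add: unit_bounded_def)
  have Fb: "\<bar>F j x\<bar> \<le> 1" if "x \<in> space M" for j x using F that by (simp add: unit_bounded_def)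
  show lim: "(\<lambda>j. F j x) \<longlonglongrightarrow> G x" if x: "x \<in> space M" for x
    unfolding G_def
  proof (rule LIMSEQ_decseq_INF)
    show "bdd_below (range (\<lambda>j. F j x))"
      using Fb[OF x] by (intro bdd_belowI2[where m = "-1"]) (simp add: abs_le_iff minus_le_iff)
    show "decseq (\<lambda>j. F j x)" using dec[OF x] by (simp add: decseq_Suc_iff)
  qed
  have Gm [measurable]: "G \<in> borel_measurable M" unfolding G_def by measurable
  have "\<bar>G x\<bar> \<le> 1" if x: "x \<in> space M" for x
    using tendsto_rabs[OF lim[OF x]] Fb[OF x] by (intro LIMSEQ_le_const2) auto
  then show G: "unit_bounded M G" by (simp add: unit_bounded_def)
  have [measurable]: "f \<in> borel_measurable M" using f by (simp add: unit_bounded_def)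
  have int: "integrable M f" "integrable M (F j)" "integrable M G" for j
    using unit_bounded_integrable f F G by auto
  have "(\<lambda>j. \<integral>x. f x - F j x \<partial>M) \<longlonglongrightarrow> (\<integral>x. f x - G x \<partial>M)"
  proof (rule integral_dominated_convergence[where w = "\<lambda>_. 2"])
    show "AE x in M. (\<lambda>j. f x - F j x) \<longlonglongrightarrow> f x - G x"
      using lim by (intro AE_I2 tendsto_diff tendsto_const)
    show "AE x in M. norm (f x - F j x) \<le> 2" for j
    proof (rule AE_I2)
      fix x assume x: "x \<in> space M"
      have "\<bar>f x\<bar> \<le> 1" using f x by (simp add: unit_bounded_def)
      then show "norm (f x - F j x) \<le> 2" using Fb[OF x, of j] by simp
    qed
  qed auto
  then have "(\<integral>x. f x - G x \<partial>M) \<le> e" using bound by (intro LIMSEQ_le_const2) auto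
  moreover have "(\<integral>x. \<bar>f x - G x\<bar> \<partial>M) = (\<integral>x. f x - G x \<partial>M)"
  proof (rule Bochner_Integration.integral_cong[OF refl])
    fix x assume x: "x \<in> space M"
    have "G x \<le> f x" using lim[OF x] below[OF x] by (intro LIMSEQ_le_const2) auto
    then show "\<bar>f x - G x\<bar> = f x - G x" by simp
  qed
  ultimately show "(\<integral>x. \<bar>f x - G x\<bar> \<partial>M) \<le> e" by simp
qed

text \<open>The function \<open>h k\<close> enters the procedure at stage \<open>k\<close>, so that only finitely many functions
  have to be controlled at each stage, and its total displacement is a geometric tail. The
  error therefore tends to \<open>0\<close> as \<open>k\<close> grows: a function that occurs infinitely often in the
  sequence \<open>h\<close> is approximated arbitrarily well.\<close>

lemma simultaneous_regularization:
  assumes h: "\<And>k. unit_bounded M (h k)"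
    and return: "\<And>g. unit_bounded M g \<Longrightarrow> (\<lambda>i. \<integral>x. \<bar>g x - g (\<tau> (q i) x)\<bar> \<partial>M) \<longlonglongrightarrow> 0"
  shows "\<exists>(r :: nat \<Rightarrow> nat) G. strict_mono r \<and> (\<forall>k. unit_bounded M (G k)) \<and>
    (\<forall>k. (\<integral>x. \<bar>h k x - G k x\<bar> \<partial>M) \<le> 2 * (1/2) ^ k) \<and>
    (\<forall>k. \<forall>j\<ge>k. lipschitz_along M (1 / real (Suc j)) (\<tau> (q (r j))) (G k))"
proof -
  \<comment> \<open>A state consists of the current versions of all functions and the last chosen index.\<close>
  define P :: "nat \<Rightarrow> (nat \<Rightarrow> 'a \<Rightarrow> real) \<times> nat \<Rightarrow> bool"
    where "P j s \<longleftrightarrow> (\<forall>k. unit_bounded M (fst s k)) \<and> (j = 0 \<longrightarrow> fst s = h)" for j s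
  define next_fun :: "nat \<Rightarrow> (nat \<Rightarrow> 'a \<Rightarrow> real) \<Rightarrow> nat \<Rightarrow> nat \<Rightarrow> 'a \<Rightarrow> real"
    where "next_fun j F i k = (if k \<le> j then inf_conv \<tau> (1 / real (Suc j)) (q i) (F k) else F k)"
    for j F i k
  define R :: "nat \<Rightarrow> (nat \<Rightarrow> 'a \<Rightarrow> real) \<times> nat \<Rightarrow> (nat \<Rightarrow> 'a \<Rightarrow> real) \<times> nat \<Rightarrow> bool"
    where "R j s t \<longleftrightarrow> snd s < snd t \<and> fst t = next_fun j (fst s) (snd t) \<and>
      (\<forall>k\<le>j. (\<integral>x. fst s k x - fst t k x \<partial>M) \<le> (1/2) ^ j)" for j s t
  have "\<exists>s. \<forall>j. P j (s j) \<and> R j (s j) (s (Suc j))"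
  proof (rule dependent_nat_choice)
    show "\<exists>s. P 0 s" by (rule exI[of _ "(h, 0)"]) (simp add: P_def h)
    fix s j assume "P j s"
    then have F: "unit_bounded M (fst s k)" for k by (simp add: P_def)
    let ?c = "1 / real (Suc j)"
    have "\<forall>\<^sub>F i in sequentially. (\<integral>x. fst s k x - inf_conv \<tau> ?c (q i) (fst s k) x \<partial>M) < (1/2) ^ j"
      for k
      using inf_conv_L1_tendsto[OF F[of k] _ return[OF F[of k]], of ?c]
      by (intro order_tendstoD(2)[where y = 0]) auto
    then have "\<forall>\<^sub>F i in sequentially. \<forall>k\<in>{..j}.
        (\<integral>x. fst s k x - inf_conv \<tau> ?c (q i) (fst s k) x \<partial>M) < (1/2) ^ j"
      by (intro eventually_ball_finite) auto
    then have "\<forall>\<^sub>F i in sequentially. snd s < i \<and> (\<forall>k\<in>{..j}.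
        (\<integral>x. fst s k x - inf_conv \<tau> ?c (q i) (fst s k) x \<partial>M) < (1/2) ^ j)"
      using eventually_gt_at_top by (rule eventually_conj[rotated])
    then obtain i where i: "snd s < i" "\<forall>k\<in>{..j}.
        (\<integral>x. fst s k x - inf_conv \<tau> ?c (q i) (fst s k) x \<partial>M) < (1/2) ^ j"
      by (auto dest: eventually_happens)
    have "P (Suc j) (next_fun j (fst s) i, i)"
      using F by (auto simp: P_def next_fun_def intro!: unit_bounded_inf_conv)
    moreover have "R j s (next_fun j (fst s) i, i)"
      using i by (auto simp: R_def next_fun_def less_imp_le)
    ultimately show "\<exists>t. P (Suc j) t \<and> R j s t" by blast
  qed
  then obtain s where s: "P j (s j)" "R j (s j) (s (Suc j))" for j by blast
  define F where "F j k = fst (s j) k" for j k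
  define r where "r j = snd (s (Suc j))" for j
  define G where "G k = (\<lambda>x. INF j. F (k + j) k x)" for k
  have ub: "unit_bounded M (F j k)" for j k using s(1)[of j] by (simp add: P_def F_def)
  have step: "F (Suc j) k = (if k \<le> j then inf_conv \<tau> (1 / real (Suc j)) (q (r j)) (F j k) else F j k)"
    for j k
    using s(2)[of j] by (simp add: R_def F_def r_def next_fun_def)
  have small: "(\<integral>x. F j k x - F (Suc j) k x \<partial>M) \<le> (1/2) ^ j" if "k \<le> j" for j k
    using s(2)[of j] that unfolding R_def F_def by blast
  have "strict_mono r"
    using s(2) by (auto simp: strict_mono_Suc_iff r_def R_def)
  have start: "F j k = h k" if "j \<le> k" for j k
    using that
  proof (induction j)
    case 0
    then show ?case using s(1)[of 0] by (simp add: P_def F_def)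
  next
    case (Suc j)
    then show ?case by (simp add: step)
  qed
  have dec: "F (Suc j) k x \<le> F j k x" if "x \<in> space M" for j k x
    using inf_conv_le[OF ub _ that] by (simp add: step)
  have below: "F (k + j) k x \<le> h k x" if "x \<in> space M" for j k x
  proof (induction j)
    case (Suc j)
    then show ?case using dec[OF that, of "k + j" k] by simp
  qed (simp add: start)
  \<comment> \<open>The displacements up to stage \<open>k + j\<close> form a partial sum of a geometric series.\<close>
  have total: "(\<integral>x. h k x - F (k + j) k x \<partial>M) \<le> 2 * (1/2) ^ k - 2 * (1/2) ^ (k + j)" for j k
  proof (induction j)
    case 0
    then show ?case by (simp add: start)
  next
    case (Suc j)
    have "(\<integral>x. h k x - F (k + Suc j) k x \<partial>M)
        = (\<integral>x. (h k x - F (k + j) k x) + (F (k + j) k x - F (Suc (k + j)) k x) \<partial>M)"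
      by simp
    also have "\<dots> = (\<integral>x. h k x - F (k + j) k x \<partial>M)
        + (\<integral>x. F (k + j) k x - F (Suc (k + j)) k x \<partial>M)"
      using ub h by (intro Bochner_Integration.integral_add Bochner_Integration.integrable_diff
          unit_bounded_integrable)
    also have "\<dots> \<le> 2 * (1/2) ^ k - 2 * (1/2) ^ (k + j) + (1/2) ^ (k + j)"
      using Suc small[of k "k + j"] by simp
    also have "\<dots> = 2 * (1/2) ^ k - 2 * (1/2) ^ (k + Suc j)" by simp
    finally show ?case .
  qed
  have lip: "lipschitz_along M (1 / real (Suc j)) (\<tau> (q (r j))) (F (Suc j + i) k)"
    if "k \<le> j" for i j k
  proof (induction i)
    case 0
    then show ?case using that lipschitz_along_inf_conv[OF ub] by (simp add: step)
  next
    case (Suc i)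
    have "F (Suc j + Suc i) k
        = inf_conv \<tau> (1 / real (Suc (Suc j + i))) (q (r (Suc j + i))) (F (Suc j + i) k)"
      using step[of "Suc j + i" k] that by simp
    then show ?case using lipschitz_along_inf_conv_other[OF ub _ Suc] by simp
  qed
  have le: "(\<integral>x. h k x - F (k + j) k x \<partial>M) \<le> 2 * (1/2) ^ k" for j k
    using total[of k j] by (smt (verit) zero_le_power divide_nonneg_nonneg)
  have dec': "F (k + Suc j) k x \<le> F (k + j) k x" if "x \<in> space M" for j k x
    using dec[OF that, of "k + j" k] by simp
  note lim = monotone_limit_unit_bounded[where F = "\<lambda>j. F (k + j) k" for k, OF ub dec' le h below]
  have G: "unit_bounded M (G k)" "(\<integral>x. \<bar>h k x - G k x\<bar> \<partial>M) \<le> 2 * (1/2) ^ k" for k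
    unfolding G_def by (rule lim; assumption)+
  have conv: "(\<lambda>j. F (k + j) k x) \<longlonglongrightarrow> G k x" if "x \<in> space M" for k x
    unfolding G_def using that by (rule lim(3)[rotated -1])
  have "lipschitz_along M (1 / real (Suc j)) (\<tau> (q (r j))) (G k)" if "k \<le> j" for k j
    unfolding lipschitz_along_def
  proof
    fix x assume x: "x \<in> space M"
    let ?y = "\<tau> (q (r j)) x"
    have "(\<lambda>i. \<bar>F (k + i) k x - F (k + i) k ?y\<bar>) \<longlonglongrightarrow> \<bar>G k x - G k ?y\<bar>"
      using conv[OF x] conv[OF flow_space[OF x]] by (intro tendsto_intros)
    \<comment> \<open>The bound belonging to stage \<open>j\<close> holds from the next stage on.\<close>
    moreover have "\<bar>F (k + i) k x - F (k + i) k ?y\<bar> \<le> 1 / real (Suc j)" if "Suc j - k \<le> i" for i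
    proof -
      have "Suc j + (k + i - Suc j) = k + i" using that \<open>k \<le> j\<close> by simp
      then show ?thesis
        using lip[OF \<open>k \<le> j\<close>, of "k + i - Suc j"] x by (simp only: lipschitz_along_def)
    qed
    ultimately show "\<bar>G k x - G k ?y\<bar> \<le> 1 / real (Suc j)"
      by (intro LIMSEQ_le_const2) auto
  qed
  then show ?thesis using \<open>strict_mono r\<close> G by blast
qed

end

section \<open>Density in the space of square integrable functions\<close>

lemma norm_add_squared_le: "(norm (a + b))\<^sup>2 \<le> 2 * (norm a)\<^sup>2 + 2 * (norm b)\<^sup>2"
  for a b :: "'b::real_normed_vector"
proof -
  have "(norm (a + b))\<^sup>2 \<le> (norm a + norm b)\<^sup>2"
    by (intro power_mono norm_triangle_ineq) simp
  also have "\<dots> \<le> 2 * (norm a)\<^sup>2 + 2 * (norm b)\<^sup>2"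
    using sum_squares_bound[of "norm a" "norm b"] by (simp add: power2_sum)
  finally show ?thesis .
qed

lemma L2_space_add:
  assumes "f \<in> L2_space M" "g \<in> L2_space M"
  shows "(\<lambda>x. f x + g x) \<in> L2_space M"
    and "(\<integral>x. (norm (f x + g x))\<^sup>2 \<partial>M) \<le> 2 * (\<integral>x. (norm (f x))\<^sup>2 \<partial>M) + 2 * (\<integral>x. (norm (g x))\<^sup>2 \<partial>M)"
proof -
  have [measurable]: "f \<in> borel_measurable M" "g \<in> borel_measurable M"
    and int: "integrable M (\<lambda>x. (norm (f x))\<^sup>2)" "integrable M (\<lambda>x. (norm (g x))\<^sup>2)"
    using assms by (auto simp: L2_space_def)
  have sum: "integrable M (\<lambda>x. 2 * (norm (f x))\<^sup>2 + 2 * (norm (g x))\<^sup>2)"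
    using int by simp
  have int': "integrable M (\<lambda>x. (norm (f x + g x))\<^sup>2)"
  proof (rule Bochner_Integration.integrable_bound[OF sum])
    show "AE x in M. norm ((norm (f x + g x))\<^sup>2) \<le> norm (2 * (norm (f x))\<^sup>2 + 2 * (norm (g x))\<^sup>2)"
      using norm_add_squared_le by (intro AE_I2) simp
  qed measurable
  then show "(\<lambda>x. f x + g x) \<in> L2_space M" by (simp add: L2_space_def)
  have "(\<integral>x. (norm (f x + g x))\<^sup>2 \<partial>M) \<le> (\<integral>x. 2 * (norm (f x))\<^sup>2 + 2 * (norm (g x))\<^sup>2 \<partial>M)"
    by (intro integral_mono int' sum norm_add_squared_le)
  then show "(\<integral>x. (norm (f x + g x))\<^sup>2 \<partial>M)
      \<le> 2 * (\<integral>x. (norm (f x))\<^sup>2 \<partial>M) + 2 * (\<integral>x. (norm (g x))\<^sup>2 \<partial>M)"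
    using int by simp
qed

lemma L2_space_scale: "f \<in> L2_space M \<Longrightarrow> (\<lambda>x. c * f x) \<in> L2_space M"
  by (auto simp: L2_space_def norm_mult power_mult_distrib)

lemma L2_space_diff:
  assumes "f \<in> L2_space M" "g \<in> L2_space M"
  shows "(\<lambda>x. f x - g x) \<in> L2_space M"
  using L2_space_add(1)[OF assms(1) L2_space_scale[OF assms(2), of "-1"]] by simp

lemma (in finite_measure) Linf_le_L2:
  assumes "f \<in> borel_measurable M" "AE x in M. norm (f x) \<le> B"
  shows "f \<in> L2_space M"
proof -
  have "integrable M (\<lambda>x. (norm (f x))\<^sup>2)"
  proof (rule integrable_const_bound[where B = "B\<^sup>2"])
    show "AE x in M. norm ((norm (f x))\<^sup>2) \<le> B\<^sup>2"
      using assms(2) by eventually_elim (simp add: power_mono)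
  qed (use assms(1) in measurable)
  with assms(1) show ?thesis by (simp add: L2_space_def)
qed

text \<open>The closure of \<open>A\<close> in \<open>L2_space M\<close>, written with squared norms to avoid square roots and the
  Minkowski inequality.\<close>

definition L2_closure :: "'a measure \<Rightarrow> ('a \<Rightarrow> complex) set \<Rightarrow> ('a \<Rightarrow> complex) set" where
  "L2_closure M A =
     {f \<in> L2_space M. \<forall>e>0. \<exists>g\<in>A. (\<integral>x. (norm (f x - g x))\<^sup>2 \<partial>M) < e}"

lemma L2_closureD:
  assumes "f \<in> L2_closure M A" "e > 0"
  obtains g where "g \<in> A" "(\<integral>x. (norm (f x - g x))\<^sup>2 \<partial>M) < e"
  using assms by (auto simp: L2_closure_def)

lemma L2_closure_add:
  assumes A: "A \<subseteq> L2_space M" "\<And>f g. f \<in> A \<Longrightarrow> g \<in> A \<Longrightarrow> (\<lambda>x. f x + g x) \<in> A"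
    and f: "f \<in> L2_closure M A" and g: "g \<in> L2_closure M A"
  shows "(\<lambda>x. f x + g x) \<in> L2_closure M A"
  unfolding L2_closure_def
proof (intro CollectI conjI allI impI)
  have L2: "f \<in> L2_space M" "g \<in> L2_space M" using f g by (auto simp: L2_closure_def)
  then show "(\<lambda>x. f x + g x) \<in> L2_space M" by (rule L2_space_add)
  fix e :: real assume "e > 0"
  then have e4: "e / 4 > 0" by simp
  obtain u where u: "u \<in> A" "(\<integral>x. (norm (f x - u x))\<^sup>2 \<partial>M) < e / 4"
    using f e4 by (rule L2_closureD)
  obtain v where v: "v \<in> A" "(\<integral>x. (norm (g x - v x))\<^sup>2 \<partial>M) < e / 4"
    using g e4 by (rule L2_closureD)
  have uv: "u \<in> L2_space M" "v \<in> L2_space M" using u(1) v(1) A(1) by auto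
  have "(\<integral>x. (norm ((f x - u x) + (g x - v x)))\<^sup>2 \<partial>M) < e"
    using L2_space_add(2)[OF L2_space_diff[OF L2(1) uv(1)] L2_space_diff[OF L2(2) uv(2)]] u(2) v(2)
    by linarith
  moreover have "(\<lambda>x. norm ((f x - u x) + (g x - v x))) = (\<lambda>x. norm (f x + g x - (u x + v x)))"
    by (simp add: algebra_simps)
  ultimately have "(\<integral>x. (norm (f x + g x - (u x + v x)))\<^sup>2 \<partial>M) < e" by metis
  then show "\<exists>w\<in>A. (\<integral>x. (norm (f x + g x - w x))\<^sup>2 \<partial>M) < e"
    using A(2)[OF u(1) v(1)] by (intro bexI[of _ "\<lambda>x. u x + v x"])
qed

lemma L2_closure_scale:
  assumes A: "A \<subseteq> L2_space M" "\<And>f. f \<in> A \<Longrightarrow> (\<lambda>x. c * f x) \<in> A"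
    and f: "f \<in> L2_closure M A"
  shows "(\<lambda>x. c * f x) \<in> L2_closure M A"
  unfolding L2_closure_def
proof (intro CollectI conjI allI impI)
  show "(\<lambda>x. c * f x) \<in> L2_space M" using f by (auto simp: L2_closure_def intro: L2_space_scale)
  fix e :: real assume e: "e > 0"
  have c: "0 < (norm c)\<^sup>2 + 1" by (simp add: add_nonneg_pos)
  obtain u where u: "u \<in> A" "(\<integral>x. (norm (f x - u x))\<^sup>2 \<partial>M) < e / ((norm c)\<^sup>2 + 1)"
    using L2_closureD[OF f divide_pos_pos[OF e c]] .
  let ?I = "\<integral>x. (norm (f x - u x))\<^sup>2 \<partial>M"
  have "(\<integral>x. (norm (c * f x - c * u x))\<^sup>2 \<partial>M) = (norm c)\<^sup>2 * ?I"
    unfolding right_diff_distrib[symmetric] norm_mult power_mult_distrib by simp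
  also have "\<dots> \<le> ((norm c)\<^sup>2 + 1) * ?I" by (intro mult_right_mono) auto
  also have "\<dots> < e" using u(2) c by (simp add: field_simps)
  finally show "\<exists>w\<in>A. (\<integral>x. (norm (c * f x - w x))\<^sup>2 \<partial>M) < e"
    using A(2)[OF u(1)] by (intro bexI[of _ "\<lambda>x. c * u x"])
qed

lemma L2_closure_closed:
  assumes A: "A \<subseteq> L2_space M" and f: "f \<in> L2_space M"
    and approx: "\<And>e. e > 0 \<Longrightarrow> \<exists>g\<in>L2_closure M A. (\<integral>x. (norm (f x - g x))\<^sup>2 \<partial>M) < e"
  shows "f \<in> L2_closure M A"
  unfolding L2_closure_def
proof (intro CollectI conjI allI impI f)
  fix e :: real assume e: "e > 0"
  then obtain g where g: "g \<in> L2_closure M A" "(\<integral>x. (norm (f x - g x))\<^sup>2 \<partial>M) < e / 4"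
    using approx[of "e / 4"] by auto
  have "e / 4 > 0" using e by simp
  then obtain u where u: "u \<in> A" "(\<integral>x. (norm (g x - u x))\<^sup>2 \<partial>M) < e / 4"
    by (rule L2_closureD[OF g(1)])
  have gu: "g \<in> L2_space M" "u \<in> L2_space M" using g(1) u(1) A by (auto simp: L2_closure_def)
  have "(\<integral>x. (norm ((f x - g x) + (g x - u x)))\<^sup>2 \<partial>M) < e"
    using L2_space_add(2)[OF L2_space_diff[OF f gu(1)] L2_space_diff[OF gu]] g(2) u(2) by linarith
  then show "\<exists>u\<in>A. (\<integral>x. (norm (f x - u x))\<^sup>2 \<partial>M) < e"
    using u(1) by (intro bexI[of _ u]) simp
qed

lemma dense_for_L2_closure:
  assumes "A \<subseteq> L2_space M" "L2_space M \<subseteq> L2_closure M A"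
  shows "dense_for (L2_norm M) A (L2_space M)"
  unfolding dense_for_def
proof (intro conjI ballI allI impI assms(1))
  fix f e assume "f \<in> L2_space M" and e: "(e::real) > 0"
  then have "f \<in> L2_closure M A" using assms(2) by blast
  then obtain g where g: "g \<in> A" "(\<integral>x. (norm (f x - g x))\<^sup>2 \<partial>M) < e\<^sup>2"
    using zero_less_power[OF e] by (rule L2_closureD)
  from real_sqrt_less_mono[OF g(2)] show "\<exists>g\<in>A. L2_norm M (\<lambda>x. f x - g x) < e"
    using g(1) e by (intro bexI[of _ g]) (auto simp: L2_norm_def)
qed

text \<open>Among functions bounded by \<open>1\<close>, smallness in \<open>L1\<close> implies smallness in \<open>L2\<close>: the difference
  is at most \<open>2\<close>, so its square is at most twice its absolute value.\<close>

lemma (in finite_measure) L1_limit_in_L2_closure: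
  assumes f: "unit_bounded M f"
    and approx: "\<And>e. e > 0 \<Longrightarrow> \<exists>g. unit_bounded M g \<and> (\<lambda>x. complex_of_real (g x)) \<in> A \<and>
      (\<integral>x. \<bar>f x - g x\<bar> \<partial>M) < e"
  shows "(\<lambda>x. complex_of_real (f x)) \<in> L2_closure M A"
  unfolding L2_closure_def
proof (intro CollectI conjI allI impI)
  have [measurable]: "f \<in> borel_measurable M" using f by (simp add: unit_bounded_def)
  show "(\<lambda>x. complex_of_real (f x)) \<in> L2_space M"
    by (rule Linf_le_L2[where B = 1]) (use f in \<open>auto simp: unit_bounded_def\<close>)
  fix e :: real assume "e > 0"
  then obtain g where g: "unit_bounded M g" "(\<lambda>x. complex_of_real (g x)) \<in> A"
    "(\<integral>x. \<bar>f x - g x\<bar> \<partial>M) < e / 2"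
    using approx[of "e / 2"] by auto
  have int: "integrable M (\<lambda>x. \<bar>f x - g x\<bar>)"
    using unit_bounded_integrable f g(1) by auto
  have [measurable]: "g \<in> borel_measurable M" using g(1) by (simp add: unit_bounded_def)
  have sq: "(f x - g x)\<^sup>2 \<le> 2 * \<bar>f x - g x\<bar>" if "x \<in> space M" for x
  proof -
    have "\<bar>f x\<bar> \<le> 1" "\<bar>g x\<bar> \<le> 1" using f g(1) that by (auto simp: unit_bounded_def)
    then have "\<bar>f x - g x\<bar> * \<bar>f x - g x\<bar> \<le> 2 * \<bar>f x - g x\<bar>"
      by (intro mult_right_mono) linarith+
    then show ?thesis by (simp add: power2_eq_square)
  qed
  have "(\<integral>x. (f x - g x)\<^sup>2 \<partial>M) \<le> (\<integral>x. 2 * \<bar>f x - g x\<bar> \<partial>M)"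
  proof (rule integral_mono)
    show "integrable M (\<lambda>x. 2 * \<bar>f x - g x\<bar>)" using int by simp
    then show "integrable M (\<lambda>x. (f x - g x)\<^sup>2)"
      by (rule Bochner_Integration.integrable_bound) (use sq in \<open>auto intro!: AE_I2\<close>)
  qed (rule sq)
  also have "\<dots> < e" using g(3) by simp
  finally have "(\<integral>x. (norm (complex_of_real (f x) - complex_of_real (g x)))\<^sup>2 \<partial>M) < e"
    unfolding of_real_diff[symmetric] norm_of_real power2_abs .
  with g(2) show "\<exists>u\<in>A. (\<integral>x. (norm (complex_of_real (f x) - u x))\<^sup>2 \<partial>M) < e"
    by (intro bexI[where P = "\<lambda>u. (\<integral>x. (norm (complex_of_real (f x) - u x))\<^sup>2 \<partial>M) < e"])
qed

definition truncate :: "real \<Rightarrow> real" where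
  "truncate t = max (-1) (min 1 t)"

lemma truncate_measurable [measurable]: "truncate \<in> borel_measurable borel"
  unfolding truncate_def by measurable

lemma abs_truncate_le: "\<bar>truncate t\<bar> \<le> 1"
  by (simp add: truncate_def)

text \<open>The functions \<open>real (Suc m) * truncate (u x / real (Suc m))\<close> cut \<open>u\<close> off at height \<open>Suc m\<close> and
  converge to \<open>u\<close> in \<open>L2\<close> by dominated convergence. Scaling before truncating keeps the test
  functions bounded by \<open>1\<close>.\<close>

lemma rescaled_truncate_in_L2_closure:
  fixes u :: "'a \<Rightarrow> real"
  assumes A: "A \<subseteq> L2_space M" "\<And>c f. f \<in> A \<Longrightarrow> (\<lambda>x. c * f x) \<in> A"
    and u [measurable]: "u \<in> borel_measurable M" and sq: "integrable M (\<lambda>x. (u x)\<^sup>2)"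
    and trunc: "\<And>m. (\<lambda>x. complex_of_real (truncate (u x / real (Suc m)))) \<in> L2_closure M A"
  shows "(\<lambda>x. complex_of_real (u x)) \<in> L2_closure M A"
proof (rule L2_closure_closed[OF A(1)])
  show "(\<lambda>x. complex_of_real (u x)) \<in> L2_space M" using sq by (simp add: L2_space_def)
  fix e :: real assume e: "e > 0"
  let ?t = "\<lambda>m x. real (Suc m) * truncate (u x / real (Suc m))"
  have "(\<lambda>m. \<integral>x. (u x - ?t m x)\<^sup>2 \<partial>M) \<longlonglongrightarrow> (\<integral>x. 0 \<partial>M)"
  proof (rule integral_dominated_convergence[OF _ _ sq])
    show "AE x in M. (\<lambda>m. (u x - ?t m x)\<^sup>2) \<longlonglongrightarrow> 0"
    proof (rule AE_I2, rule tendsto_eventually)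
      fix x
      obtain N where N: "\<bar>u x\<bar> \<le> real N" using real_arch_simple by blast
      show "\<forall>\<^sub>F m in sequentially. (u x - ?t m x)\<^sup>2 = 0"
        using eventually_ge_at_top[of N]
      proof eventually_elim
        case (elim m)
        then have "\<bar>u x\<bar> \<le> real (Suc m)" using N by linarith
        then have "\<bar>u x / real (Suc m)\<bar> \<le> 1" by simp
        then have "truncate (u x / real (Suc m)) = u x / real (Suc m)"
          unfolding truncate_def by linarith
        then show ?case by simp
      qed
    qed
    show "AE x in M. norm ((u x - ?t m x)\<^sup>2) \<le> (u x)\<^sup>2" for m
    proof (rule AE_I2)
      fix x
      have "\<bar>v - truncate v\<bar> \<le> \<bar>v\<bar>" for v unfolding truncate_def by linarith
      from mult_left_mono[OF this, of "real (Suc m)" "u x / real (Suc m)"]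
      have "\<bar>real (Suc m) * (u x / real (Suc m) - truncate (u x / real (Suc m)))\<bar> \<le> \<bar>u x\<bar>"
        by (simp add: abs_mult)
      then have "\<bar>u x - ?t m x\<bar> \<le> \<bar>u x\<bar>" by (simp add: right_diff_distrib)
      then show "norm ((u x - ?t m x)\<^sup>2) \<le> (u x)\<^sup>2" by (simp add: abs_le_square_iff)
    qed
  qed measurable
  then have "\<forall>\<^sub>F m in sequentially. (\<integral>x. (u x - ?t m x)\<^sup>2 \<partial>M) < e"
    using e by (intro order_tendstoD(2)) auto
  then obtain m where m: "(\<integral>x. (u x - ?t m x)\<^sup>2 \<partial>M) < e" by (auto dest: eventually_happens)
  have "(\<lambda>x. complex_of_real (real (Suc m)) * complex_of_real (truncate (u x / real (Suc m))))
      \<in> L2_closure M A"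
    by (rule L2_closure_scale[OF A(1) A(2) trunc])
  moreover have "(\<integral>x. (norm (complex_of_real (u x) - complex_of_real (real (Suc m)) *
      complex_of_real (truncate (u x / real (Suc m)))))\<^sup>2 \<partial>M) < e"
    using m unfolding of_real_mult[symmetric] of_real_diff[symmetric] norm_of_real power2_abs .
  ultimately show "\<exists>g\<in>L2_closure M A. (\<integral>x. (norm (complex_of_real (u x) - g x))\<^sup>2 \<partial>M) < e"
    by (intro bexI[where P = "\<lambda>g. (\<integral>x. (norm (complex_of_real (u x) - g x))\<^sup>2 \<partial>M) < e"])
qed

lemma L2_space_subset_closure:
  assumes A: "A \<subseteq> L2_space M" "\<And>f g. f \<in> A \<Longrightarrow> g \<in> A \<Longrightarrow> (\<lambda>x. f x + g x) \<in> A"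
      "\<And>c f. f \<in> A \<Longrightarrow> (\<lambda>x. c * f x) \<in> A"
    and D: "dense_for (L2_norm M) D (L2_space M)"
    and re: "\<And>d m. d \<in> D \<Longrightarrow> (\<lambda>x. complex_of_real (truncate (Re (d x) / real (Suc m)))) \<in> L2_closure M A"
    and im: "\<And>d m. d \<in> D \<Longrightarrow> (\<lambda>x. complex_of_real (truncate (Im (d x) / real (Suc m)))) \<in> L2_closure M A"
  shows "L2_space M \<subseteq> L2_closure M A"
proof
  have D_closure: "d \<in> L2_closure M A" if d: "d \<in> D" for d
  proof -
    have [measurable]: "d \<in> borel_measurable M" and sq: "integrable M (\<lambda>x. (norm (d x))\<^sup>2)"
      using d D by (auto simp: dense_for_def L2_space_def)
    have Re_sq: "integrable M (\<lambda>x. (Re (d x))\<^sup>2)" and Im_sq: "integrable M (\<lambda>x. (Im (d x))\<^sup>2)"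
      by (rule Bochner_Integration.integrable_bound[OF sq];
          simp add: cmod_power2)+
    have "(\<lambda>x. complex_of_real (Re (d x))) \<in> L2_closure M A"
      by (rule rescaled_truncate_in_L2_closure[OF A(1,3) _ Re_sq re[OF d]]) measurable
    moreover have "(\<lambda>x. complex_of_real (Im (d x))) \<in> L2_closure M A"
      by (rule rescaled_truncate_in_L2_closure[OF A(1,3) _ Im_sq im[OF d]]) measurable
    ultimately have "(\<lambda>x. complex_of_real (Re (d x)) + \<i> * complex_of_real (Im (d x))) \<in> L2_closure M A"
      by (intro L2_closure_add[OF A(1,2)] L2_closure_scale[OF A(1,3)])
    then show ?thesis by (simp flip: complex_eq)
  qed
  fix f assume f: "f \<in> L2_space M"
  show "f \<in> L2_closure M A"
  proof (rule L2_closure_closed[OF A(1) f])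
    fix e :: real assume e: "e > 0"
    then have "sqrt e > 0" by simp
    then obtain d where "d \<in> D" "L2_norm M (\<lambda>x. f x - d x) < sqrt e"
      using D f unfolding dense_for_def by blast
    then show "\<exists>g\<in>L2_closure M A. (\<integral>x. (norm (f x - g x))\<^sup>2 \<partial>M) < e"
      using D_closure by (intro bexI[of _ d]) (auto simp: L2_norm_def)
  qed
qed

section \<open>The algebra generated by a sequence of functions\<close>

text \<open>Terms describing the elements of a generated ring, so that countability of the ring is
  that of a datatype. The constants are the Gaussian rationals.\<close>

datatype ring_term = Gen nat | Const rat rat | Plus ring_term ring_term | Times ring_term ring_term

instance ring_term :: countable
  by countable_datatype

primrec eval_term :: "(nat \<Rightarrow> 'a \<Rightarrow> complex) \<Rightarrow> ring_term \<Rightarrow> 'a \<Rightarrow> complex" where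
  "eval_term G (Gen k) x = G k x"
| "eval_term G (Const a b) x = Complex (of_rat a) (of_rat b)"
| "eval_term G (Plus s t) x = eval_term G s x + eval_term G t x"
| "eval_term G (Times s t) x = eval_term G s x * eval_term G t x"

definition generated_ring :: "(nat \<Rightarrow> 'a \<Rightarrow> complex) \<Rightarrow> ('a \<Rightarrow> complex) set" where
  "generated_ring G = range (eval_term G)"

lemma countable_generated_ring: "countable (generated_ring G)"
  by (simp add: generated_ring_def)

lemma generated_ring_closed:
  assumes "f \<in> generated_ring G" "g \<in> generated_ring G"
  shows "(\<lambda>x. f x + g x) \<in> generated_ring G" "(\<lambda>x. f x * g x) \<in> generated_ring G"
proof -
  obtain s t where [simp]: "f = eval_term G s" "g = eval_term G t"
    using assms by (auto simp: generated_ring_def)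
  have "(\<lambda>x. f x + g x) = eval_term G (Plus s t)" "(\<lambda>x. f x * g x) = eval_term G (Times s t)"
    by auto
  then show "(\<lambda>x. f x + g x) \<in> generated_ring G" "(\<lambda>x. f x * g x) \<in> generated_ring G"
    unfolding generated_ring_def by blast+
qed

lemma generator_in_generated_ring: "G k \<in> generated_ring G"
proof -
  have "G k = eval_term G (Gen k)" by auto
  then show ?thesis unfolding generated_ring_def by blast
qed

lemma const_approx_generated_ring:
  assumes "e > 0"
  shows "\<exists>w. (\<lambda>x. w) \<in> generated_ring G \<and> norm (c - w) < e"
proof -
  obtain a where "Re c - e / 2 < of_rat a" "of_rat a < Re c + e / 2"
    using of_rat_dense[of "Re c - e / 2" "Re c + e / 2"] assms by auto
  then have a: "\<bar>Re c - of_rat a\<bar> < e / 2" by linarith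
  obtain b where "Im c - e / 2 < of_rat b" "of_rat b < Im c + e / 2"
    using of_rat_dense[of "Im c - e / 2" "Im c + e / 2"] assms by auto
  then have b: "\<bar>Im c - of_rat b\<bar> < e / 2" by linarith
  let ?w = "Complex (of_rat a) (of_rat b)"
  have "norm (c - ?w) \<le> \<bar>Re (c - ?w)\<bar> + \<bar>Im (c - ?w)\<bar>" by (rule cmod_le)
  also have "\<dots> < e" using a b by simp
  finally have "norm (c - ?w) < e" .
  moreover have "(\<lambda>x. ?w) = eval_term G (Const a b)" by auto
  ultimately show ?thesis unfolding generated_ring_def by (metis rangeI)
qed

definition uniformly_rigid :: "'a measure \<Rightarrow> (nat \<Rightarrow> 'a \<Rightarrow> 'a) \<Rightarrow> ('a \<Rightarrow> complex) \<Rightarrow> bool" where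
  "uniformly_rigid M U f \<longleftrightarrow> f \<in> borel_measurable M \<and> bounded (f ` space M) \<and>
     uniform_limit (space M) (\<lambda>i x. f (U i x)) f sequentially"

lemma uniformly_rigid_of_lipschitz:
  assumes g: "unit_bounded M g"
    and lip: "\<And>j. k \<le> j \<Longrightarrow> lipschitz_along M (1 / real (Suc j)) (U j) g"
  shows "uniformly_rigid M U (\<lambda>x. complex_of_real (g x))"
  unfolding uniformly_rigid_def
proof (intro conjI uniform_limitI)
  have [measurable]: "g \<in> borel_measurable M" using g by (simp add: unit_bounded_def)
  show "(\<lambda>x. complex_of_real (g x)) \<in> borel_measurable M" by measurable
  show "bounded ((\<lambda>x. complex_of_real (g x)) ` space M)"
    unfolding bounded_iff using g by (intro exI[of _ 1]) (auto simp: unit_bounded_def)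
  fix e :: real assume "e > 0"
  then have "\<forall>\<^sub>F j in sequentially. 1 / real (Suc j) < e"
    using LIMSEQ_inverse_real_of_nat by (intro order_tendstoD(2)) (auto simp: inverse_eq_divide)
  then show "\<forall>\<^sub>F j in sequentially. \<forall>x\<in>space M.
      dist (complex_of_real (g (U j x))) (complex_of_real (g x)) < e"
    using eventually_ge_at_top[of k]
  proof eventually_elim
    case (elim j)
    show ?case
    proof
      fix x assume "x \<in> space M"
      then have "\<bar>g x - g (U j x)\<bar> \<le> 1 / real (Suc j)"
        using lip[OF elim(2)] by (simp only: lipschitz_along_def)
      then show "dist (complex_of_real (g (U j x))) (complex_of_real (g x)) < e"
        using elim(1) by (simp add: dist_of_real dist_real_def abs_minus_commute)
    qed
  qed
qed

lemma uniformly_rigid_generated_ring: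
  assumes G: "\<And>k. uniformly_rigid M U (G k)" and f: "f \<in> generated_ring G"
  shows "uniformly_rigid M U f"
proof -
  have "uniformly_rigid M U (eval_term G t)" for t
  proof (induction t)
    case (Gen k)
    have "eval_term G (Gen k) = G k" by auto
    then show ?case using G by simp
  next
    case (Const a b)
    have "eval_term G (Const a b) = (\<lambda>x. Complex (of_rat a) (of_rat b))" by auto
    then show ?case by (simp add: uniformly_rigid_def uniform_limit_const image_constant_conv)
  next
    case (Plus s t)
    then show ?case
      by (auto simp: uniformly_rigid_def intro!: uniform_limit_add bounded_plus_comp)
  next
    case (Times s t)
    have "eval_term G (Times s t) = (\<lambda>x. eval_term G s x * eval_term G t x)" by auto
    moreover have "bounded ((\<lambda>x. eval_term G s x * eval_term G t x) ` space M)"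
    proof -
      obtain B C where B: "\<And>x. x \<in> space M \<Longrightarrow> norm (eval_term G s x) \<le> B"
        and C: "\<And>x. x \<in> space M \<Longrightarrow> norm (eval_term G t x) \<le> C"
        using Times by (auto simp: uniformly_rigid_def bounded_iff)
      have "norm (eval_term G s x * eval_term G t x) \<le> B * C" if "x \<in> space M" for x
        unfolding norm_mult using B[OF that] C[OF that]
        by (intro mult_mono) (auto intro: order_trans[OF norm_ge_zero])
      then show ?thesis by (auto simp: bounded_iff)
    qed
    ultimately show ?case
      using Times by (auto simp: uniformly_rigid_def intro!: uniform_lim_mult)
  qed
  then show ?thesis using f by (auto simp: generated_ring_def)
qed

text \<open>The closure for the essential supremum norm. Being defined by almost everywhere
  inequalities, it is automatically a union of classes modulo almost everywhere equality.\<close>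

definition essential_closure :: "'a measure \<Rightarrow> ('a \<Rightarrow> complex) set \<Rightarrow> ('a \<Rightarrow> complex) set" where
  "essential_closure M Q =
     {f \<in> borel_measurable M. \<forall>e>0. \<exists>q\<in>Q. AE x in M. norm (f x - q x) < e}"

lemma essential_closureD:
  assumes "f \<in> essential_closure M Q" "e > 0"
  obtains q where "q \<in> Q" "AE x in M. norm (f x - q x) < e"
  using assms by (auto simp: essential_closure_def)

lemma essential_closure_superset: "Q \<subseteq> borel_measurable M \<Longrightarrow> Q \<subseteq> essential_closure M Q"
  unfolding essential_closure_def by (auto intro!: bexI)

lemma essential_closure_bounded:
  assumes Q: "\<And>q. q \<in> Q \<Longrightarrow> bounded (q ` space M)" and f: "f \<in> essential_closure M Q"
  obtains B where "B \<ge> 0" "AE x in M. norm (f x) \<le> B"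
proof -
  obtain q where q: "q \<in> Q" "AE x in M. norm (f x - q x) < 1"
    using f by (rule essential_closureD) auto
  obtain B where B: "\<And>x. x \<in> space M \<Longrightarrow> norm (q x) \<le> B"
    using Q[OF q(1)] by (auto simp: bounded_iff)
  have "AE x in M. norm (f x) \<le> \<bar>B\<bar> + 1"
    using q(2) AE_space
  proof eventually_elim
    case (elim x)
    then show ?case using B[of x] norm_triangle_sub[of "f x" "q x"] by simp
  qed
  then show ?thesis using that[of "\<bar>B\<bar> + 1"] by simp
qed

lemma Linf_norm_le:
  assumes "f \<in> borel_measurable M" "AE x in M. norm (f x) \<le> B"
  shows "Linf_norm M f \<le> ereal B"
  unfolding Linf_norm_def using assms by (intro esssup_I) auto

lemma (in prob_space) Linf_norm_nonneg: "0 \<le> Linf_norm M f"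
proof (cases "(\<lambda>x. ereal (norm (f x))) \<in> borel_measurable M")
  case True
  have "0 = esssup M (\<lambda>x. 0 :: ereal)"
    by (rule esssup_const[symmetric]) (simp add: emeasure_space_1)
  also have "\<dots> \<le> Linf_norm M f"
    unfolding Linf_norm_def by (intro esssup_mono) auto
  finally show ?thesis .
next
  case False
  then show ?thesis by (simp add: Linf_norm_def esssup_non_measurable)
qed

lemma essential_closure_mult:
  assumes Q: "\<And>q. q \<in> Q \<Longrightarrow> bounded (q ` space M)"
      "\<And>p q. p \<in> Q \<Longrightarrow> q \<in> Q \<Longrightarrow> (\<lambda>x. p x * q x) \<in> Q"
    and f: "f \<in> essential_closure M Q" and g: "g \<in> essential_closure M Q"
  shows "(\<lambda>x. f x * g x) \<in> essential_closure M Q"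
  unfolding essential_closure_def
proof (intro CollectI conjI allI impI)
  show "(\<lambda>x. f x * g x) \<in> borel_measurable M" using f g by (auto simp: essential_closure_def)
  fix e :: real assume e: "e > 0"
  obtain B where B: "B \<ge> 0" "AE x in M. norm (f x) \<le> B"
    using essential_closure_bounded[OF Q(1) f] by blast
  obtain C where C: "C \<ge> 0" "AE x in M. norm (g x) \<le> C"
    using essential_closure_bounded[OF Q(1) g] by blast
  define d where "d = min 1 (e / (B + C + 2))"
  have pos: "0 < B + C + 2" using B(1) C(1) by simp
  have d: "0 < d" "d \<le> 1" "d \<le> e / (B + C + 2)"
    using divide_pos_pos[OF e pos] by (simp_all add: d_def)
  obtain p where p: "p \<in> Q" "AE x in M. norm (f x - p x) < d" using f d(1) by (rule essential_closureD)
  obtain q where q: "q \<in> Q" "AE x in M. norm (g x - q x) < d" using g d(1) by (rule essential_closureD)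
  have "AE x in M. norm (f x * g x - p x * q x) < e"
    using B(2) C(2) p(2) q(2)
  proof eventually_elim
    case (elim x)
    have "norm (q x) \<le> C + 1"
      using elim(2,4) d(2) norm_triangle_sub[of "q x" "g x"] by (simp add: norm_minus_commute)
    have "f x * g x - p x * q x = f x * (g x - q x) + (f x - p x) * q x"
      by (simp add: algebra_simps)
    then have "norm (f x * g x - p x * q x)
        \<le> norm (f x) * norm (g x - q x) + norm (f x - p x) * norm (q x)"
      by (metis norm_mult norm_triangle_ineq)
    also have "\<dots> \<le> B * d + d * (C + 1)"
      using elim \<open>norm (q x) \<le> C + 1\<close> B(1) d(1) by (intro add_mono mult_mono) auto
    also have "\<dots> < d * (B + C + 2)" using d(1) by (simp add: algebra_simps)
    also have "\<dots> \<le> e" using d(3) pos by (simp add: pos_le_divide_eq)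
    finally show ?case .
  qed
  then show "\<exists>r\<in>Q. AE x in M. norm (f x * g x - r x) < e"
    using Q(2)[OF p(1) q(1)] by (intro bexI[of _ "\<lambda>x. p x * q x"])
qed

lemma essential_closure_add:
  assumes Q: "\<And>p q. p \<in> Q \<Longrightarrow> q \<in> Q \<Longrightarrow> (\<lambda>x. p x + q x) \<in> Q"
    and f: "f \<in> essential_closure M Q" and g: "g \<in> essential_closure M Q"
  shows "(\<lambda>x. f x + g x) \<in> essential_closure M Q"
  unfolding essential_closure_def
proof (intro CollectI conjI allI impI)
  show "(\<lambda>x. f x + g x) \<in> borel_measurable M" using f g by (auto simp: essential_closure_def)
  fix e :: real assume e: "e > 0"
  obtain p where p: "p \<in> Q" "AE x in M. norm (f x - p x) < e / 2"
    using f e by (auto elim: essential_closureD[of f M Q "e / 2"])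
  obtain q where q: "q \<in> Q" "AE x in M. norm (g x - q x) < e / 2"
    using g e by (auto elim: essential_closureD[of g M Q "e / 2"])
  have "AE x in M. norm (f x + g x - (p x + q x)) < e"
    using p(2) q(2)
  proof eventually_elim
    case (elim x)
    then show ?case
      using norm_triangle_ineq[of "f x - p x" "g x - q x"] by (simp add: algebra_simps)
  qed
  then show "\<exists>r\<in>Q. AE x in M. norm (f x + g x - r x) < e"
    using Q[OF p(1) q(1)] by (intro bexI[of _ "\<lambda>x. p x + q x"])
qed

lemma essential_closure_const:
  assumes "\<And>e. e > 0 \<Longrightarrow> \<exists>w. (\<lambda>x. w) \<in> Q \<and> norm (c - w) < e"
  shows "(\<lambda>x. c) \<in> essential_closure M Q"
  unfolding essential_closure_def
proof (intro CollectI conjI allI impI)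
  fix e :: real assume "e > 0"
  then obtain w where "(\<lambda>x. w) \<in> Q" "norm (c - w) < e" using assms by blast
  then show "\<exists>q\<in>Q. AE x in M. norm (c - q x) < e" by (intro bexI[of _ "\<lambda>x. w"]) auto
qed simp

text \<open>The set \<open>Q\<close> is only a ring, but its closure admits all complex scalars: constant
  functions belong to the closure, and multiplication by a scalar is a product.\<close>

lemma Linf_subalgebra_essential_closure:
  assumes Q: "\<And>q. q \<in> Q \<Longrightarrow> bounded (q ` space M)"
    and add: "\<And>p q. p \<in> Q \<Longrightarrow> q \<in> Q \<Longrightarrow> (\<lambda>x. p x + q x) \<in> Q"
    and mult: "\<And>p q. p \<in> Q \<Longrightarrow> q \<in> Q \<Longrightarrow> (\<lambda>x. p x * q x) \<in> Q"
    and const: "\<And>c e. e > 0 \<Longrightarrow> \<exists>w. (\<lambda>x. w) \<in> Q \<and> norm (c - w) < e"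
  shows "Linf_subalgebra M (essential_closure M Q)"
  unfolding Linf_subalgebra_def
proof (intro conjI ballI allI impI subsetI)
  fix f assume f: "f \<in> essential_closure M Q"
  obtain B where B: "AE x in M. norm (f x) \<le> B" using essential_closure_bounded[OF Q f] by blast
  have meas: "f \<in> borel_measurable M" using f by (simp add: essential_closure_def)
  have "Linf_norm M f < \<infinity>"
    using Linf_norm_le[OF meas B] by (rule order.strict_trans1) simp
  then show "f \<in> Linf_space M" using meas by (simp add: Linf_space_def)
next
  fix f g assume f: "f \<in> essential_closure M Q"
    and g: "g \<in> borel_measurable M" and eq: "AE x in M. f x = g x"
  show "g \<in> essential_closure M Q"
    unfolding essential_closure_def
  proof (intro CollectI conjI allI impI g)
    fix e :: real assume "e > 0"
    then obtain q where q: "q \<in> Q" "AE x in M. norm (f x - q x) < e"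
      using f by (auto elim: essential_closureD)
    have "AE x in M. norm (g x - q x) < e" using q(2) eq by eventually_elim simp
    then show "\<exists>q\<in>Q. AE x in M. norm (g x - q x) < e" using q(1) by blast
  qed
next
  fix c f assume f: "f \<in> essential_closure M Q"
  show "(\<lambda>x. c * f x) \<in> essential_closure M Q"
    by (rule essential_closure_mult[OF Q mult essential_closure_const[OF const] f])
qed (auto intro: essential_closure_add essential_closure_mult essential_closure_const assms)

lemma separable_essential_closure:
  assumes "countable Q" "Q \<subseteq> borel_measurable M"
  shows "separable_for (Linf_norm M) (essential_closure M Q)"
  unfolding separable_for_def dense_for_def
proof (intro exI conjI ballI allI impI)
  show "countable Q" "Q \<subseteq> essential_closure M Q"
    using assms essential_closure_superset by auto
  fix f and e :: ereal assume f: "f \<in> essential_closure M Q" and "0 < e"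
  then obtain d where d: "0 < ereal d" "ereal d < e" using ereal_dense2 by blast
  then obtain q where q: "q \<in> Q" "AE x in M. norm (f x - q x) < d"
    using f by (auto elim: essential_closureD)
  have "f \<in> borel_measurable M" "q \<in> borel_measurable M"
    using f q(1) assms(2) by (auto simp: essential_closure_def)
  moreover have "AE x in M. norm (f x - q x) \<le> d" using q(2) by eventually_elim simp
  ultimately have "Linf_norm M (\<lambda>x. f x - q x) \<le> ereal d" by (intro Linf_norm_le) auto
  then show "\<exists>g\<in>Q. Linf_norm M (\<lambda>x. f x - g x) < e"
    using q(1) d(2) by (intro bexI[of _ q]) auto
qed

text \<open>A uniform approximation \<open>q\<close> of \<open>f\<close> also approximates after composition with \<open>U i\<close>, because
  \<open>U i\<close> preserves null sets; so the return of \<open>q\<close> carries over to \<open>f\<close> with an error split in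
  three.\<close>

lemma (in prob_space) Linf_norm_return_tendsto:
  assumes U: "\<And>i. measure_preserving M (U i)"
    and Q: "\<And>q. q \<in> Q \<Longrightarrow> uniformly_rigid M U q"
    and f: "f \<in> essential_closure M Q"
  shows "(\<lambda>i. Linf_norm M (\<lambda>x. f x - f (U i x))) \<longlonglongrightarrow> 0"
proof (rule order_tendstoI)
  fix a :: ereal assume "a < 0"
  then show "\<forall>\<^sub>F i in sequentially. a < Linf_norm M (\<lambda>x. f x - f (U i x))"
    using Linf_norm_nonneg by (intro always_eventually allI) (rule order.strict_trans2)
next
  fix a :: ereal assume "0 < a"
  then obtain e where e: "0 < ereal e" "ereal e < a" using ereal_dense2 by blast
  then obtain q where q: "q \<in> Q" "AE x in M. norm (f x - q x) < e / 3"
    using f by (auto elim: essential_closureD[of f M Q "e / 3"])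
  have [measurable]: "f \<in> borel_measurable M" using f by (simp add: essential_closure_def)
  have "uniform_limit (space M) (\<lambda>i x. q (U i x)) q sequentially"
    using Q[OF q(1)] by (simp add: uniformly_rigid_def)
  then have "\<forall>\<^sub>F i in sequentially. \<forall>x\<in>space M. dist (q (U i x)) (q x) < e / 3"
    using e(1) by (intro uniform_limitD) auto
  then show "\<forall>\<^sub>F i in sequentially. Linf_norm M (\<lambda>x. f x - f (U i x)) < a"
  proof eventually_elim
    case (elim i)
    have U_meas [measurable]: "U i \<in> M \<rightarrow>\<^sub>M M" and U_distr: "distr M M (U i) = M"
      using U[of i] by (auto simp: measure_preserving_def)
    have "AE x in M. norm (f (U i x) - q (U i x)) < e / 3"
      by (rule AE_distrD[OF U_meas]) (simp only: U_distr q(2))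
    with q(2) AE_space have "AE x in M. norm (f x - f (U i x)) \<le> e"
    proof eventually_elim
      case near: (elim x)
      have "norm (q (U i x) - q x) < e / 3" using near(2) elim by (simp add: dist_norm)
      then have "norm ((f x - q x) - (f (U i x) - q (U i x)) - (q (U i x) - q x)) \<le> e"
        using norm_triangle_ineq4[of "(f x - q x) - (f (U i x) - q (U i x))" "q (U i x) - q x"]
          norm_triangle_ineq4[of "f x - q x" "f (U i x) - q (U i x)"] near(1,3) by linarith
      then show ?case by simp
    qed
    then have "Linf_norm M (\<lambda>x. f x - f (U i x)) \<le> ereal e" by (intro Linf_norm_le) auto
    then show ?case using e(2) by simp
  qed
qed

section \<open>The dense subalgebra\<close>

theorem corollary1p2:
  fixes M :: "'a measure" and T :: "'a \<Rightarrow> 'a" and n :: "nat \<Rightarrow> nat"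
  assumes "ergodic_system M T"
    and "separable_for (L2_norm M) (L2_space M)"
    and "strict_mono n"
    and "rigid_for M T n"
  shows "\<exists>r A. strict_mono (r :: nat \<Rightarrow> nat) \<and>
           Linf_subalgebra M A \<and>
           separable_for (Linf_norm M) A \<and>
           dense_for (L2_norm M) A (L2_space M) \<and>
           (\<forall>f\<in>A. (\<lambda>i. Linf_norm M (\<lambda>x. f x - f ((T ^^ n (r i)) x))) \<longlonglongrightarrow> 0)"
proof -
  have sys: "measure_preserving_system M T" using assms(1) by (simp add: ergodic_system_def)
  interpret measure_preserving_flow M "iterate_int M T" by (rule iterate_int_flow[OF sys])
  obtain D where D: "countable D" "dense_for (L2_norm M) D (L2_space M)"
    using assms(2) by (auto simp: separable_for_def)
  have "(\<lambda>x. 0) \<in> L2_space M" by (simp add: L2_space_def)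
  then have "D \<noteq> {}" using D(2) unfolding dense_for_def by (metis empty_iff zero_less_one)
  define d where "d = from_nat_into D"
  have d: "range d = D" unfolding d_def using range_from_nat_into[OF \<open>D \<noteq> {}\<close> D(1)] .
  define part :: "nat \<times> nat \<times> bool \<Rightarrow> 'a \<Rightarrow> real" where
    "part = (\<lambda>(p, m, b) x. truncate ((if b then Re (d p x) else Im (d p x)) / real (Suc m)))"
  have part: "unit_bounded M (part t)" for t
  proof -
    obtain p m b where t: "t = (p, m, b)" by (cases t)
    have [measurable]: "d p \<in> borel_measurable M"
      using D(2) d by (auto simp: dense_for_def L2_space_def)
    show ?thesis by (auto simp: unit_bounded_def part_def t abs_truncate_le)
  qed
  \<comment> \<open>Ignoring the first component of the decoded pair makes every test function occur infinitely often.\<close>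
  define h where "h k = part (from_nat (snd (prod_decode k)))" for k
  have h: "unit_bounded M (h k)" for k by (simp only: h_def part)
  have return: "(\<lambda>i. \<integral>x. \<bar>u x - u (iterate_int M T (int (n i)) x)\<bar> \<partial>M) \<longlonglongrightarrow> 0"
    if "unit_bounded M u" for u
    using L1_return_of_rigid[OF that assms(4) iterate_int_of_nat] .
  obtain r G where r: "strict_mono r" and G: "\<And>k. unit_bounded M (G k)"
    and close: "\<And>k. (\<integral>x. \<bar>h k x - G k x\<bar> \<partial>M) \<le> 2 * (1/2) ^ k"
    and lip: "\<And>k j. k \<le> j \<Longrightarrow>
      lipschitz_along M (1 / real (Suc j)) (iterate_int M T (int (n (r j)))) (G k)"
    using simultaneous_regularization[of h "\<lambda>i. int (n i)", OF h return] by metis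
  define g where "g k = (\<lambda>x. complex_of_real (G k x))" for k
  define U where "U j = T ^^ n (r j)" for j
  define A where "A = essential_closure M (generated_ring g)"
  have U: "measure_preserving M (U j)" for j
    using sys by (auto simp: U_def measure_preserving_system_def intro: measure_preserving_funpow)
  have "uniformly_rigid M U (g k)" for k
    unfolding g_def 
    by (rule uniformly_rigid_of_lipschitz[OF G, of k])
      (use lip in \<open>simp only: U_def iterate_int_of_nat\<close>)
  note rigid = uniformly_rigid_generated_ring[OF this]
  have Q: "bounded (f ` space M)" "f \<in> borel_measurable M" if "f \<in> generated_ring g" for f
    using rigid[OF that] by (auto simp: uniformly_rigid_def)
  have sub: "Linf_subalgebra M A"
    unfolding A_def
    by (rule Linf_subalgebra_essential_closure[OF Q(1) generated_ring_closed const_approx_generated_ring])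
  then have A_closed: "\<And>u v. u \<in> A \<Longrightarrow> v \<in> A \<Longrightarrow> (\<lambda>x. u x + v x) \<in> A"
    "\<And>c u. u \<in> A \<Longrightarrow> (\<lambda>x. c * u x) \<in> A"
    by (auto simp: Linf_subalgebra_def)
  have A_L2: "A \<subseteq> L2_space M"
  proof
    fix f assume f: "f \<in> A"
    then obtain B where "AE x in M. norm (f x) \<le> B"
      unfolding A_def using essential_closure_bounded[OF Q(1)] by blast
    then show "f \<in> L2_space M"
      using f by (intro Linf_le_L2) (auto simp: A_def essential_closure_def)
  qed
  have gA: "g k \<in> A" for k
    unfolding A_def using essential_closure_superset[of "generated_ring g" M] Q(2)
      generator_in_generated_ring[of g k] by blast
  have part_closure: "(\<lambda>x. complex_of_real (part t x)) \<in> L2_closure M A" for t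
  proof (rule L1_limit_in_L2_closure[OF part])
    fix e :: real assume "e > 0"
    then obtain l where l: "(1/2) ^ l < e / 2" using real_arch_pow_inv[of "e / 2" "1/2"] by auto
    \<comment> \<open>An occurrence of the test function at a position \<open>k \<ge> l\<close>, where the error is small.\<close>
    define k where "k = prod_encode (l, to_nat t)"
    have hk: "h k = part t" by (simp add: h_def k_def)
    have "(1/2 :: real) ^ k \<le> (1/2) ^ l"
      unfolding k_def by (intro power_decreasing le_prod_encode_1) auto
    then have "(\<integral>x. \<bar>part t x - G k x\<bar> \<partial>M) < e"
      using close[of k] l unfolding hk by linarith
    then show "\<exists>u. unit_bounded M u \<and> (\<lambda>x. complex_of_real (u x)) \<in> A \<and>
        (\<integral>x. \<bar>part t x - u x\<bar> \<partial>M) < e"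
      using G[of k] gA[of k] unfolding g_def by blast
  qed
  have "dense_for (L2_norm M) A (L2_space M)"
  proof (rule dense_for_L2_closure[OF A_L2 L2_space_subset_closure[OF A_L2 A_closed D(2)]])
    fix f m assume "f \<in> D"
    then obtain p where "f = d p" using d by auto
    then show "(\<lambda>x. complex_of_real (truncate (Re (f x) / real (Suc m)))) \<in> L2_closure M A"
      "(\<lambda>x. complex_of_real (truncate (Im (f x) / real (Suc m)))) \<in> L2_closure M A"
      using part_closure[of "(p, m, True)"] part_closure[of "(p, m, False)"]
      by (simp_all only: part_def prod.case if_True if_False)
  qed
  moreover have "separable_for (Linf_norm M) A"
    unfolding A_def using Q(2) by (intro separable_essential_closure countable_generated_ring) auto
  moreover have "(\<lambda>i. Linf_norm M (\<lambda>x. f x - f ((T ^^ n (r i)) x))) \<longlonglongrightarrow> 0" if "f \<in> A" for f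
    using Linf_norm_return_tendsto[OF U rigid that[unfolded A_def]] by (simp only: U_def)
  ultimately show ?thesis using r sub by blast
qed

end
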